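(* Every proper, geodesic, Ptolemy metric space is uniquely geodesic.
   Context: Write $|xy|$ for the distance between points $x,y$ of a metric space. A metric space $X$ is Ptolemy if $|xy|\,|uv| \le |xu|\,|yv| + |xv|\,|yu|$ for all $x,y,u,v\in X$. It is proper if all closed bounded subsets are compact. A metric space $X$ is geodesic if for any two points $x,y\in X$ there is an isometric embedding $\gamma:[0,|xy|]\to X$ with $\gamma(0)=x$ and $\gamma(|xy|)=y$; it is uniquely geodesic if for any $x,y\in X$ there is exactly one such $\gamma$. *)

theory Defs
  imports "HOL-Analysis.Analysis"
begin

definition isometric_embedding ::
  "'a set \<Rightarrow> ('a \<Rightarrow> 'a \<Rightarrow> real) \<Rightarrow> 'b set \<Rightarrow> ('b \<Rightarrow> 'b \<Rightarrow> real) \<Rightarrow> ('a \<Rightarrow> 'b) \<Rightarrow> bool"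
  where "isometric_embedding A dA B dB f \<longleftrightarrow>
    f \<in> A \<rightarrow> B \<and> (\<forall>s\<in>A. \<forall>t\<in>A. dB (f s) (f t) = dA s t)"

context Metric_space
begin

definition ptolemy_space :: bool
  where "ptolemy_space \<longleftrightarrow>
    (\<forall>x\<in>M. \<forall>y\<in>M. \<forall>u\<in>M. \<forall>v\<in>M. d x y * d u v \<le> d x u * d y v + d x v * d y u)"

definition proper_space :: bool
  where "proper_space \<longleftrightarrow>
    (\<forall>S. closedin mtopology S \<and> mbounded S \<longrightarrow> compactin mtopology S)"

text \<open>
  The set below represents the maps from the interval \<open>{0..d x y}\<close> into the space that are
  geodesics from \<open>x\<close> to \<open>y\<close>. HOL functions are total, so membership in \<open>extensional\<close> pins down
  the irrelevant values outside the interval; without it, uniqueness could not hold literally.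
\<close>

definition geodesics :: "'a \<Rightarrow> 'a \<Rightarrow> (real \<Rightarrow> 'a) set"
  where "geodesics x y =
    {\<gamma> \<in> extensional {0..d x y}.
       isometric_embedding {0..d x y} dist M d \<gamma> \<and> \<gamma> 0 = x \<and> \<gamma> (d x y) = y}"

definition geodesic_space :: bool
  where "geodesic_space \<longleftrightarrow> (\<forall>x\<in>M. \<forall>y\<in>M. \<exists>\<gamma>. \<gamma> \<in> geodesics x y)"

definition uniquely_geodesic_space :: bool
  where "uniquely_geodesic_space \<longleftrightarrow> (\<forall>x\<in>M. \<forall>y\<in>M. \<exists>!\<gamma>. \<gamma> \<in> geodesics x y)"

end

end

theory Submission
  imports Defs "HOL-Real_Asymp.Real_Asymp"
begin

text \<open>
  Suppose \<open>\<gamma>\<close> and \<open>\<eta>\<close> are geodesics from \<open>x\<close> to \<open>y\<close>, \<open>L = |xy|\<close>, and let \<open>m s\<close> be a midpoint of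
  \<open>\<gamma> s\<close> and \<open>\<eta> s\<close>, whose distance is \<open>l s\<close>. By the Ptolemy inequality distance functions are
  convex, so \<open>m s\<close> has the same distances to \<open>x\<close> and \<open>y\<close> as \<open>\<gamma> s\<close>. For \<open>s < t\<close> the quadruples
  \<open>(x, m t, \<gamma> s, \<eta> s)\<close> and \<open>(y, m s, \<gamma> t, \<eta> t)\<close> bound the distances between the points at level
  \<open>s\<close> and those at level \<open>t\<close> from below with a gain linear in \<open>t - s\<close>, while
  \<open>(\<gamma> s, m t, \<gamma> t, m s)\<close> and \<open>(\<eta> s, m t, \<eta> t, m s)\<close> bound them from above. Together they give
  \<open>l s\<^sup>2 + l t\<^sup>2 \<le> 4 * L * (|m s m t| + |t - s|)\<close>. Near a parameter with \<open>l \<noteq> 0\<close>, the midpoints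
  are thus uniformly separated, which is impossible in a compact set.
\<close>

text \<open>Write \<open>A = q + u\<close> and \<open>A' = p + u'\<close> with both errors at most
  \<open>\<delta>\<close>: the product bound then controls the linear part
  \<open>p * u + q * u'\<close>, and likewise for \<open>B\<close>, \<open>B'\<close>. Weighting the
  last two hypotheses by \<open>p\<close> and \<open>q\<close> bounds the same linear parts from
  below by a multiple of \<open>\<delta>\<close>, which cancels.\<close>

lemma squares_le_of_quadrilateral_bounds:
  fixes p q A A' B B' \<delta> \<mu> L :: real
  assumes "0 < \<delta>" "0 < L" "0 \<le> p" "0 \<le> q"
    and "\<bar>A - q\<bar> \<le> \<delta>" "\<bar>A' - p\<bar> \<le> \<delta>" "\<bar>B - q\<bar> \<le> \<delta>" "\<bar>B' - p\<bar> \<le> \<delta>"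
    and A: "A * A' \<le> \<delta> * \<mu> + p * q" and B: "B * B' \<le> \<delta> * \<mu> + p * q"
    and p: "2 * p * (L + \<delta>) \<le> L * (A + B)" and q: "2 * q * (L + \<delta>) \<le> L * (A' + B')"
  shows "p\<^sup>2 + q\<^sup>2 \<le> L * (\<mu> + \<delta>)"
proof -
  have *: "p * u + q * u' \<le> \<delta> * \<mu> + \<delta> * \<delta>"
    if "\<bar>u\<bar> \<le> \<delta>" "\<bar>u'\<bar> \<le> \<delta>" "(q + u) * (p + u') \<le> \<delta> * \<mu> + p * q" for u u'
  proof -
    have "\<bar>u * u'\<bar> \<le> \<delta> * \<delta>"
      unfolding abs_mult using that by (intro mult_mono) auto
    with that(3) show ?thesis by (simp add: algebra_simps)
  qed
  have uA: "p * (A - q) + q * (A' - p) \<le> \<delta> * \<mu> + \<delta> * \<delta>"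
    using assms by (intro *) auto
  have uB: "p * (B - q) + q * (B' - p) \<le> \<delta> * \<mu> + \<delta> * \<delta>"
    using assms by (intro *) auto
  \<comment> \<open>The added square is what remains of the terms without \<open>\<delta>\<close> in
    the weighted sum.\<close>
  have "2 * \<delta> * (p\<^sup>2 + q\<^sup>2) \<le> 2 * \<delta> * (p\<^sup>2 + q\<^sup>2) + 2 * L * (p - q)\<^sup>2"
    using \<open>0 < L\<close> by simp
  also have "\<dots> = p * (2 * p * (L + \<delta>)) + q * (2 * q * (L + \<delta>)) - 4 * L * p * q"
    by (simp add: algebra_simps power2_eq_square)
  also have "\<dots> \<le> p * (L * (A + B)) + q * (L * (A' + B')) - 4 * L * p * q"
    using mult_left_mono[OF p \<open>0 \<le> p\<close>] mult_left_mono[OF q \<open>0 \<le> q\<close>] by linarith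
  also have "\<dots> = L * ((p * (A - q) + q * (A' - p)) + (p * (B - q) + q * (B' - p)))"
    by (simp add: algebra_simps)
  also have "\<dots> \<le> L * (2 * (\<delta> * \<mu> + \<delta> * \<delta>))"
    using uA uB \<open>0 < L\<close> by (intro mult_left_mono) auto
  also have "\<dots> = 2 * \<delta> * (L * (\<mu> + \<delta>))"
    by (simp add: algebra_simps)
  finally show ?thesis
    using \<open>0 < \<delta>\<close> by simp
qed

context Metric_space
begin

definition midpoint_of :: "'a \<Rightarrow> 'a \<Rightarrow> 'a \<Rightarrow> bool"
  where "midpoint_of p q m \<longleftrightarrow> m \<in> M \<and> d p m = d p q / 2 \<and> d m q = d p q / 2"

lemma ptolemyD:
  assumes "ptolemy_space" "x \<in> M" "y \<in> M" "u \<in> M" "v \<in> M"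
  shows "d x y * d u v \<le> d x u * d y v + d x v * d y u"
  using assms unfolding ptolemy_space_def by blast

lemma geodesics_dist:
  assumes "\<gamma> \<in> geodesics x y" "s \<in> {0..d x y}" "t \<in> {0..d x y}"
  shows "d (\<gamma> s) (\<gamma> t) = \<bar>s - t\<bar>"
  using assms by (auto simp: geodesics_def isometric_embedding_def dist_real_def)

lemma geodesics_in_M:
  assumes "\<gamma> \<in> geodesics x y" "s \<in> {0..d x y}"
  shows "\<gamma> s \<in> M"
  using assms by (auto simp: geodesics_def isometric_embedding_def)

lemma geodesics_dist_endpoints:
  assumes "\<gamma> \<in> geodesics x y" "s \<in> {0..d x y}"
  shows "d x (\<gamma> s) = s" "d (\<gamma> s) y = d x y - s"
  using assms geodesics_dist[OF assms(1), of 0 s] geodesics_dist[OF assms(1), of s "d x y"]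
  by (auto simp: geodesics_def)

lemma geodesic_space_midpoint:
  assumes "geodesic_space" "p \<in> M" "q \<in> M"
  obtains m where "midpoint_of p q m"
proof -
  obtain \<gamma> where \<gamma>: "\<gamma> \<in> geodesics p q"
    using assms unfolding geodesic_space_def by blast
  have h: "d p q / 2 \<in> {0..d p q}"
    by simp
  show thesis
    using that geodesics_dist_endpoints[OF \<gamma> h] geodesics_in_M[OF \<gamma> h]
    by (simp add: midpoint_of_def)
qed

text \<open>Ptolemy for the pairs \<open>z\<close>, \<open>m\<close> and \<open>p\<close>,
  \<open>q\<close>, divided by \<open>d p q\<close>; this is midpoint convexity of the distance to
  \<open>z\<close>.\<close>

lemma ptolemy_dist_midpoint_le:
  assumes "ptolemy_space" "p \<in> M" "q \<in> M" "z \<in> M" "midpoint_of p q m" "p \<noteq> q"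
  shows "d z m \<le> (d z p + d z q) / 2"
proof -
  have "0 < d p q"
    using assms by simp
  have m: "m \<in> M" "d m p = d p q / 2" "d m q = d p q / 2"
    using assms by (auto simp: midpoint_of_def commute)
  have "d z m * d p q \<le> d z p * (d p q / 2) + d z q * (d p q / 2)"
    using ptolemyD[OF assms(1,4) m(1) assms(2,3)] by (simp only: m)
  then have "d z m * d p q \<le> (d z p + d z q) / 2 * d p q"
    by (simp add: algebra_simps add_divide_distrib)
  with \<open>0 < d p q\<close> show ?thesis
    by simp
qed

lemma ptolemy_midpoint_separation:
  assumes pt: "ptolemy_space" and x: "x \<in> M" and y: "y \<in> M"
    and \<gamma>: "\<gamma> \<in> geodesics x y" and \<eta>: "\<eta> \<in> geodesics x y"
    and st: "0 < s" "s < t" "t < d x y"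
    and ne: "\<gamma> s \<noteq> \<eta> s" "\<gamma> t \<noteq> \<eta> t"
    and m: "midpoint_of (\<gamma> s) (\<eta> s) m" and n: "midpoint_of (\<gamma> t) (\<eta> t) n"
  shows "(d (\<gamma> s) (\<eta> s))\<^sup>2 + (d (\<gamma> t) (\<eta> t))\<^sup>2 \<le> 4 * d x y * (d m n + (t - s))"
proof -
  let ?L = "d x y" and ?p = "d (\<gamma> s) (\<eta> s) / 2" and ?q = "d (\<gamma> t) (\<eta> t) / 2"
  have I: "s \<in> {0..?L}" "t \<in> {0..?L}"
    using st by auto
  note M = geodesics_in_M[OF \<gamma> I(1)] geodesics_in_M[OF \<gamma> I(2)]
    geodesics_in_M[OF \<eta> I(1)] geodesics_in_M[OF \<eta> I(2)]
  note E = geodesics_dist_endpoints[OF \<gamma> I(1)] geodesics_dist_endpoints[OF \<gamma> I(2)]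
    geodesics_dist_endpoints[OF \<eta> I(1)] geodesics_dist_endpoints[OF \<eta> I(2)]
  have mn: "m \<in> M" "n \<in> M"
    using m n by (auto simp: midpoint_of_def)
  have dm: "d (\<gamma> s) m = ?p" "d (\<eta> s) m = ?p" and dn: "d (\<gamma> t) n = ?q" "d (\<eta> t) n = ?q"
    using m n by (auto simp: midpoint_of_def commute)
  have step: "d (\<gamma> s) (\<gamma> t) = t - s" "d (\<eta> s) (\<eta> t) = t - s"
    using geodesics_dist[OF \<gamma> I] geodesics_dist[OF \<eta> I] st by auto
  \<comment> \<open>Convexity bounds the distance to one endpoint from above; the triangle
    inequality through the midpoint turns this into a lower bound for the other endpoint.\<close>
  have levels: "t \<le> d x n" "?L - s \<le> d y m"
  proof -
    have "d y n \<le> ?L - t"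
      using ptolemy_dist_midpoint_le[OF pt M(2,4) y n ne(2)] E by (simp add: commute)
    then show "t \<le> d x n"
      using triangle[OF x mn(2) y] by (simp add: commute)
    have "d x m \<le> s"
      using ptolemy_dist_midpoint_le[OF pt M(1,3) x m ne(1)] E by simp
    then show "?L - s \<le> d y m"
      using triangle[OF x mn(1) y] by (simp add: commute)
  qed
  have p: "2 * ?p * (?L + (t - s)) \<le> ?L * (d (\<gamma> s) n + d (\<eta> s) n)"
  proof -
    let ?S = "d (\<gamma> s) n + d (\<eta> s) n"
    have "t * (2 * ?p) \<le> d x n * (2 * ?p)"
      using levels by (intro mult_right_mono) auto
    also have "\<dots> \<le> s * ?S"
      using ptolemyD[OF pt x mn(2) M(1,3)] E(1,5)
      by (simp add: commute[of n] distrib_left add.commute)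
    finally have *: "t * (2 * ?p) \<le> s * ?S" .
    have "2 * ?p * (s + (t - s)) \<le> s * ?S"
      using * by (simp add: mult.commute)
    then have "2 * ?p * (t - s) \<le> s * (?S - 2 * ?p)"
      by (simp add: algebra_simps)
    \<comment> \<open>The triangle inequality makes \<open>?S - 2 * ?p\<close> nonnegative, so
      \<open>s\<close> may be replaced by \<open>?L\<close>, the factor shared with the mirrored
      bound from \<open>y\<close>.\<close>
    also have "\<dots> \<le> ?L * (?S - 2 * ?p)"
      using st triangle'[OF M(1) mn(2) M(3)] by (intro mult_right_mono) auto
    finally show ?thesis
      by (simp add: algebra_simps)
  qed
  have q: "2 * ?q * (?L + (t - s)) \<le> ?L * (d (\<gamma> t) m + d (\<eta> t) m)"
  proof -
    let ?S = "d (\<gamma> t) m + d (\<eta> t) m"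
    have "(?L - s) * (2 * ?q) \<le> d y m * (2 * ?q)"
      using levels by (intro mult_right_mono) auto
    also have "\<dots> \<le> (?L - t) * ?S"
      using ptolemyD[OF pt y mn(1) M(2,4)] E(4,8)
      by (simp add: commute[of y "\<gamma> t"] commute[of y "\<eta> t"] commute[of m] distrib_left add.commute)
    finally have "2 * ?q * (t - s) \<le> (?L - t) * (?S - 2 * ?q)"
      by (simp add: algebra_simps)
    also have "\<dots> \<le> ?L * (?S - 2 * ?q)"
      using st triangle'[OF M(2) mn(1) M(4)] by (intro mult_right_mono) auto
    finally show ?thesis
      by (simp add: algebra_simps)
  qed
  have "?p\<^sup>2 + ?q\<^sup>2 \<le> ?L * (d m n + (t - s))"
  proof (rule squares_le_of_quadrilateral_bounds[OF _ _ _ _ _ _ _ _ _ _ p q])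
    show "\<bar>d (\<gamma> s) n - ?q\<bar> \<le> t - s" "\<bar>d (\<gamma> t) m - ?p\<bar> \<le> t - s"
      using triangle[OF M(1,2) mn(2)] triangle[OF M(2,1) mn(2)]
        triangle[OF M(1,2) mn(1)] triangle[OF M(2,1) mn(1)] dm dn step
      by (simp_all add: commute abs_le_iff)
    show "\<bar>d (\<eta> s) n - ?q\<bar> \<le> t - s" "\<bar>d (\<eta> t) m - ?p\<bar> \<le> t - s"
      using triangle[OF M(3,4) mn(2)] triangle[OF M(4,3) mn(2)]
        triangle[OF M(3,4) mn(1)] triangle[OF M(4,3) mn(1)] dm dn step
      by (simp_all add: commute abs_le_iff)
    \<comment> \<open>The two crossing distances are the diagonals of the quadrilateral
      \<open>\<gamma> s\<close>, \<open>\<gamma> t\<close>, \<open>n\<close>,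
      \<open>m\<close>.\<close>
    show "d (\<gamma> s) n * d (\<gamma> t) m \<le> (t - s) * d m n + ?p * ?q"
      using ptolemyD[OF pt M(1) mn(2) M(2) mn(1)]
      by (simp only: dm dn step commute[of n m] commute[of n "\<gamma> t"])
    show "d (\<eta> s) n * d (\<eta> t) m \<le> (t - s) * d m n + ?p * ?q"
      using ptolemyD[OF pt M(3) mn(2) M(4) mn(1)]
      by (simp only: dm dn step commute[of n m] commute[of n "\<eta> t"])
  qed (use st in auto)
  then show ?thesis
    by (simp add: power_divide)
qed

text \<open>A closed ball is compact, so some subsequence of \<open>\<sigma>\<close> is Cauchy, and
  \<open>f\<close> is Cauchy as well; two consecutive late terms of the subsequence serve for
  both.\<close>

lemma proper_bounded_close_terms:
  fixes \<sigma> :: "nat \<Rightarrow> 'a" and f :: "nat \<Rightarrow> real"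
  assumes "proper_space" "x \<in> M" "\<And>k. \<sigma> k \<in> M" "\<And>k. d x (\<sigma> k) \<le> R" "convergent f" "0 < e"
  obtains i j where "i < j" "d (\<sigma> i) (\<sigma> j) < e" "\<bar>f i - f j\<bar> < e"
proof -
  have "compactin mtopology (mcball x R)"
    using assms(1) unfolding proper_space_def by (simp add: mbounded_mcball)
  moreover have "range \<sigma> \<subseteq> mcball x R"
    using assms by auto
  ultimately obtain l r where r: "strict_mono r" and lim: "limitin mtopology (\<sigma> \<circ> r) l sequentially"
    unfolding compactin_sequentially by blast
  have "MCauchy (\<sigma> \<circ> r)"
    using lim by (rule convergent_imp_MCauchy[rotated]) (use assms in auto)
  then obtain N1 where N1: "d (\<sigma> (r i)) (\<sigma> (r j)) < e" if "N1 \<le> i" "N1 \<le> j" for i j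
    using \<open>0 < e\<close> unfolding MCauchy_def by force
  obtain N2 where N2: "\<bar>f i - f j\<bar> < e" if "N2 \<le> i" "N2 \<le> j" for i j
    using convergent_Cauchy[OF \<open>convergent f\<close>] \<open>0 < e\<close> unfolding Cauchy_def dist_real_def by blast
  define i where "i = max N1 N2"
  have "i \<le> r i" "r i < r (Suc i)"
    using seq_suble[OF r] r by (auto simp: strict_mono_def)
  then show thesis
    using that[of "r i" "r (Suc i)"] N1[of i "Suc i"] N2[of "r i" "r (Suc i)"] by (simp add: i_def)
qed

lemma proper_ptolemy_geodesics_agree:
  assumes pr: "proper_space" and ge: "geodesic_space" and pt: "ptolemy_space"
    and x: "x \<in> M" and y: "y \<in> M" and \<gamma>: "\<gamma> \<in> geodesics x y" and \<eta>: "\<eta> \<in> geodesics x y"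
    and c: "c \<in> {0..d x y}"
  shows "\<gamma> c = \<eta> c"
proof (rule ccontr)
  assume ne: "\<gamma> c \<noteq> \<eta> c"
  let ?L = "d x y"
  define l where "l s = d (\<gamma> s) (\<eta> s)" for s
  have l0: "0 < l c"
    using ne geodesics_in_M[OF \<gamma> c] geodesics_in_M[OF \<eta> c] by (simp add: l_def)
  have "c \<noteq> ?L"
    using \<gamma> \<eta> ne by (auto simp: geodesics_def)
  then have cL: "0 \<le> c" "c < ?L"
    using c by auto
  \<comment> \<open>The first bound leaves room below \<open>?L\<close>; the second keeps
    \<open>l\<close> above \<open>l c / 2\<close>, since \<open>l\<close> changes by at most twice
    the change of parameter.\<close>
  define e where "e = min (?L - c) (l c / 4)"
  have e: "0 < e" "e \<le> ?L - c" "e \<le> l c / 4"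
    using cL l0 by (auto simp: e_def min_def)
  \<comment> \<open>Starting the denominators at 2 keeps \<open>f 0\<close> strictly below
    \<open>c + e\<close>, hence every parameter strictly below \<open>?L\<close>.\<close>
  define f where "f k = c + e / real (k + 2)" for k :: nat
  have f: "c < f k" "f k < c + e" for k
    using e(1) by (auto simp: f_def divide_less_eq)
  have f_mono: "f j < f i" if "i < j" for i j
    using that e(1) by (simp add: f_def divide_strict_left_mono)
  have f_in: "0 < f k" "f k < ?L" "f k \<in> {0..?L}" for k
    using f[of k] e cL by auto
  have "f \<longlonglongrightarrow> c"
    unfolding f_def by real_asymp
  then have conv: "convergent f"
    by (auto simp: convergent_def)
  have lf: "l c / 2 \<le> l (f k)" for k
  proof -
    note M = geodesics_in_M[OF \<gamma> c] geodesics_in_M[OF \<eta> c]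
      geodesics_in_M[OF \<gamma> f_in(3)[of k]] geodesics_in_M[OF \<eta> f_in(3)[of k]]
    have "l c \<le> d (\<gamma> c) (\<gamma> (f k)) + (l (f k) + d (\<eta> (f k)) (\<eta> c))"
      using triangle[OF M(1,3,2)] triangle[OF M(3,4,2)] unfolding l_def by linarith
    then show ?thesis
      using geodesics_dist[OF \<gamma> c f_in(3)] geodesics_dist[OF \<eta> f_in(3) c] f[of k] e by simp
  qed
  have "\<forall>k. \<exists>m. midpoint_of (\<gamma> (f k)) (\<eta> (f k)) m"
    using geodesic_space_midpoint[OF ge geodesics_in_M[OF \<gamma> f_in(3)] geodesics_in_M[OF \<eta> f_in(3)]]
    by metis
  then obtain m where m: "midpoint_of (\<gamma> (f k)) (\<eta> (f k)) (m k)" for k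
    by metis
  have fne: "\<gamma> (f k) \<noteq> \<eta> (f k)" for k
    using lf[of k] l0 geodesics_in_M[OF \<eta> f_in(3)] by (auto simp: l_def)
  have bdd: "d x (m k) \<le> ?L" for k
  proof -
    have "d x (m k) \<le> (f k + f k) / 2"
      using ptolemy_dist_midpoint_le[OF pt geodesics_in_M[OF \<gamma> f_in(3)]
          geodesics_in_M[OF \<eta> f_in(3)] x m fne, of k]
      by (simp add: geodesics_dist_endpoints(1)[OF \<gamma> f_in(3)]
          geodesics_dist_endpoints(1)[OF \<eta> f_in(3)])
    then show ?thesis
      using f_in(2)[of k] by simp
  qed
  have mM: "m k \<in> M" for k
    using m by (simp add: midpoint_of_def)
  \<comment> \<open>Two quantities below this threshold, summed and multiplied by
    \<open>4 * ?L\<close>, stay below \<open>(l c)\<^sup>2 / 2\<close>, the lower bound from the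
    separation estimate.\<close>
  have pos: "0 < (l c)\<^sup>2 / (16 * ?L)"
    using l0 cL by simp
  obtain i j where ij: "i < j" "d (m i) (m j) < (l c)\<^sup>2 / (16 * ?L)"
      "\<bar>f i - f j\<bar> < (l c)\<^sup>2 / (16 * ?L)"
    by (rule proper_bounded_close_terms[OF pr x mM bdd conv pos])
  have "(l c)\<^sup>2 / 2 = (l c / 2)\<^sup>2 + (l c / 2)\<^sup>2"
    by (simp add: power_divide)
  also have "\<dots> \<le> (l (f j))\<^sup>2 + (l (f i))\<^sup>2"
    using lf l0 by (intro add_mono power_mono) auto
  \<comment> \<open>As \<open>f\<close> decreases, \<open>f j\<close> is the smaller parameter and
    takes the role of \<open>s\<close>.\<close>
  also have "\<dots> \<le> 4 * ?L * (d (m j) (m i) + (f i - f j))"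
    unfolding l_def
    by (rule ptolemy_midpoint_separation[OF pt x y \<gamma> \<eta> f_in(1) f_mono[OF ij(1)] f_in(2) fne fne m m])
  also have "\<dots> < 4 * ?L * ((l c)\<^sup>2 / (16 * ?L) + (l c)\<^sup>2 / (16 * ?L))"
    using ij cL by (intro mult_strict_left_mono) (auto simp: commute)
  also have "\<dots> = (l c)\<^sup>2 / 2"
    using cL by (simp add: field_simps)
  finally show False
    by simp
qed

end

theorem theorem1p2:
  fixes M :: "'a set" and d :: "'a \<Rightarrow> 'a \<Rightarrow> real"
  assumes "Metric_space M d"
    and "Metric_space.proper_space M d"
    and "Metric_space.geodesic_space M d"
    and "Metric_space.ptolemy_space M d"
  shows "Metric_space.uniquely_geodesic_space M d"
proof -
  interpret Metric_space M d
    by fact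
  \<comment> \<open>Agreement on the interval gives equality of total functions because both are
    extensional there.\<close>
  have "\<gamma> = \<eta>" if "x \<in> M" "y \<in> M" "\<gamma> \<in> geodesics x y" "\<eta> \<in> geodesics x y" for x y \<gamma> \<eta>
  proof (rule extensionalityI)
    show "\<gamma> \<in> extensional {0..d x y}" "\<eta> \<in> extensional {0..d x y}"
      using that by (auto simp: geodesics_def)
    show "\<gamma> c = \<eta> c" if "c \<in> {0..d x y}" for c
      by (rule proper_ptolemy_geodesics_agree) fact+
  qed
  then show ?thesis
    using assms(3) unfolding uniquely_geodesic_space_def geodesic_space_def
    by (intro ballI ex_ex1I) simp_all
qed

end
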